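(* Let $Q\subset\mathbb{R}^d_{\ge 0}\setminus\{\mathbf{0}\}$ be a polytope, let $f$ be a continuous and convex function on $\operatorname{conv}(Q\cup\{\mathbf{0}\})$ with $f(\mathbf{0})=0$, and let $\mu$ be a concave upper bound of $f$ on $Q$. Let $P=P(f,Q)$ and $P^0=P^0(f,Q)$ be the perspective and naïve relaxations (both defined using $\mu$), and let $\Delta(P^0,P):=\operatorname{vol}(P^0)-\operatorname{vol}(P)$. Then $$\Delta(P^0,P)=\frac{1}{d+2}\int_{Q}f(\mathbf{x})\,d\mathbf{x}-\int_0^1 z^d\int_{Q}f(z\mathbf{x})\,d\mathbf{x}\,dz.$$
   Context: A concave upper bound of $f$ on $Q$ is a concave function $\mu:Q\to\mathbb{R}$ with $\mu(\mathbf{x})\ge f(\mathbf{x})$ for all $\mathbf{x}\in Q$. For $z>0$ and $\mathbf{x}\in z\cdot Q=\{z\mathbf{q}:\mathbf{q}\in Q\}$ write $\tilde f(\mathbf{x},z):=z f(\mathbf{x}/z)$ and $\tilde\mu(\mathbf{x},z):=z\mu(\mathbf{x}/z)$, and (closure convention) $\tilde\mu(\mathbf{0},0):=0$. The perspective relaxation is $$P(f,Q):=\operatorname{convcl}\{(\mathbf{x},y,z)\in\mathbb{R}^d\times\mathbb{R}\times\mathbb{R}:\ \tilde\mu(\mathbf{x},z)\ge y\ge\tilde f(\mathbf{x},z),\ \mathbf{x}\in z\cdot Q,\ 1\ge z>0\},$$ where $\operatorname{convcl}$ denotes the closure of the convex hull, and the naïve relaxation is $$P^0(f,Q):=\{(\mathbf{x},y,z)\in\mathbb{R}^d\times\mathbb{R}\times\mathbb{R}:\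 \tilde\mu(\mathbf{x},z)\ge y\ge f(\mathbf{x}),\ \mathbf{x}\in z\cdot Q,\ 1\ge z\ge 0\}.$$ $\operatorname{vol}$ denotes Lebesgue measure in $\mathbb{R}^{d+2}$, and integrals over $Q$ are with respect to Lebesgue measure in $\mathbb{R}^d$. *)

theory Defs
  imports "HOL-Analysis.Analysis"
begin

definition concave_upper_bound_on ::
    "'a::real_vector set \<Rightarrow> ('a \<Rightarrow> real) \<Rightarrow> ('a \<Rightarrow> real) \<Rightarrow> bool" where
  "concave_upper_bound_on Q f \<mu> \<longleftrightarrow> concave_on Q \<mu> \<and> (\<forall>x\<in>Q. f x \<le> \<mu> x)"

(* The value at z = 0 is the closure convention; below it is only used at the point (0, 0). *)
definition perspective_fun :: "('a::real_vector \<Rightarrow> real) \<Rightarrow> 'a \<Rightarrow> real \<Rightarrow> real" where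
  "perspective_fun g x z = (if z = 0 then 0 else z * g (x /\<^sub>R z))"

definition perspective_relaxation ::
    "('a::euclidean_space \<Rightarrow> real) \<Rightarrow> ('a \<Rightarrow> real) \<Rightarrow> 'a set \<Rightarrow> ('a \<times> real \<times> real) set" where
  "perspective_relaxation f \<mu> Q =
     closure (convex hull {(x, y, z).
       perspective_fun \<mu> x z \<ge> y \<and> y \<ge> perspective_fun f x z \<and>
       x \<in> (\<lambda>q. z *\<^sub>R q) ` Q \<and> 1 \<ge> z \<and> z > 0})"

definition naive_relaxation ::
    "('a::euclidean_space \<Rightarrow> real) \<Rightarrow> ('a \<Rightarrow> real) \<Rightarrow> 'a set \<Rightarrow> ('a \<times> real \<times> real) set" where
  "naive_relaxation f \<mu> Q =
     {(x, y, z).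
       perspective_fun \<mu> x z \<ge> y \<and> y \<ge> f x \<and>
       x \<in> (\<lambda>q. z *\<^sub>R q) ` Q \<and> 1 \<ge> z \<and> z \<ge> 0}"

definition volume_gap :: "'a::euclidean_space set \<Rightarrow> 'a set \<Rightarrow> real" where
  "volume_gap A B = measure lebesgue A - measure lebesgue B"

end

theory Submission
  imports Defs
begin

text \<open>
  For \<open>0 < z \<le> 1\<close> and \<open>x \<in> z Q\<close>, convexity and \<open>f 0 = 0\<close> give \<open>f x \<le> z f (x / z)\<close>, so the
  perspective relaxation requires more of \<open>y\<close> than the naive one does, while the upper bound
  \<open>z \<mu> (x / z)\<close> is the same in both.  Hence the points of the naive relaxation that violate the
  perspective constraint are those with \<open>f x \<le> y < z f (x / z)\<close> (\<open>perspective_gap\<close>), a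
  region in which \<open>\<mu>\<close> does not occur.

  That the difference of the volumes is the volume of this region requires measurability and
  finiteness, although \<open>\<mu>\<close> need not be measurable or continuous up to the boundary of \<open>Q\<close>.
  Convexity supplies both.  For \<open>z > 0\<close>, and before any closed convex hull is taken, the constraint
  sets of both relaxations are intersections of convex sets, those defined through \<open>x / z\<close> being
  cones over convex sets (\<open>convex_perspective_cone\<close>); they are bounded because a concave function bounded below on a bounded set is bounded above there
  (\<open>concave_on_bounded_above\<close>).  Bounded convex sets are measurable and have negligible
  frontier, so taking the closed convex hull does not change the volume either.  The slice \<open>z = 0\<close>
  of the naive relaxation is at most a point.  This is
  \<open>volume_gap_eq_measure_perspective_gap\<close>.

  The volume of the gap is found by integrating over \<open>y\<close> first, then substituting \<open>z x\<close>
  for \<open>x\<close>, which contributes the factor \<open>z ^ d\<close> in dimension \<open>d\<close> and turns \<open>z Q\<close> into \<open>Q\<close>: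
  the remaining integrand is \<open>z ^ d * (z * f x - f (z x))\<close> on \<open>{0..1} \<times> Q\<close>, and the integral of
  \<open>z ^ (d + 1)\<close> over \<open>{0..1}\<close> is \<open>1 / (d + 2)\<close> (\<open>measure_perspective_gap\<close>).
\<close>

section \<open>Perspective cones and concave functions\<close>

text \<open>The set below is the cone over \<open>T\<close>, placed at height \<open>z = 1\<close>, without its apex.\<close>

lemma convex_perspective_cone:
  fixes T :: "('a::real_vector \<times> real) set"
  assumes "convex T"
  shows "convex {(x, y, z). 0 < z \<and> (x /\<^sub>R z, y / z) \<in> T}"
proof -
  let ?H = "(\<lambda>(x, y). (x, y, 1::real)) ` T"
  have "?H = (\<lambda>p. (0, 0, 1) + p) ` (\<lambda>(x, y). (x, y, 0)) ` T"
    by (force simp: image_iff)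
  moreover have "linear (\<lambda>(x, y). (x::'a, y::real, 0::real))"
    by (auto simp: linear_iff)
  ultimately have "convex ?H"
    by (metis assms convex_linear_image convex_translation)
  then have "convex (conic hull ?H \<inter> (snd \<circ> snd) -` {0<..})"
    by (intro convex_Int convex_conic_hull convex_linear_vimage)
       (auto intro!: linear_compose linear_fst linear_snd)
  moreover have "{(x, y, z). 0 < z \<and> (x /\<^sub>R z, y / z) \<in> T} = conic hull ?H \<inter> (snd \<circ> snd) -` {0<..}"
  proof (rule set_eqI, clarify, rule iffI)
    fix x y and z :: real
    assume "(x, y, z) \<in> {(x, y, z). 0 < z \<and> (x /\<^sub>R z, y / z) \<in> T}"
    then have z: "0 < z" and m: "(x /\<^sub>R z, y / z, 1) \<in> ?H"
      by auto
    have "z *\<^sub>R (x /\<^sub>R z, y / z, 1) \<in> conic hull ?H"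
      using z by (intro conicD[OF conic_conic_hull hull_inc[OF m]]) simp
    then show "(x, y, z) \<in> conic hull ?H \<inter> (snd \<circ> snd) -` {0<..}"
      using z by simp
  next
    fix x y and z :: real
    assume "(x, y, z) \<in> conic hull ?H \<inter> (snd \<circ> snd) -` {0<..}"
    then show "(x, y, z) \<in> {(x, y, z). 0 < z \<and> (x /\<^sub>R z, y / z) \<in> T}"
      by (auto simp: conic_hull_explicit)
  qed
  ultimately show ?thesis by simp
qed

text \<open>
  For \<open>c\<close> in the relative interior, every segment from a point \<open>q\<close> of \<open>Q\<close> to \<open>c\<close> can be prolonged
  inside \<open>Q\<close> by a ratio \<open>t\<close> that does not depend on \<open>q\<close>; a large value at \<open>q\<close> would then force a
  value below \<open>m\<close> at the far end.
\<close>

lemma concave_on_bounded_above: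
  fixes h :: "'a::euclidean_space \<Rightarrow> real"
  assumes h: "concave_on Q h" and Q: "bounded Q" and m: "\<And>x. x \<in> Q \<Longrightarrow> m \<le> h x"
  obtains M where "\<And>x. x \<in> Q \<Longrightarrow> h x \<le> M"
proof (cases "Q = {}")
  case False
  then obtain c where "c \<in> rel_interior Q"
    using concave_on_imp_convex[OF h] rel_interior_eq_empty by blast
  then obtain e where c: "c \<in> Q" and e: "0 < e" "cball c e \<inter> affine hull Q \<subseteq> Q"
    by (auto simp: mem_rel_interior_cball)
  obtain B where B: "0 < B" "\<And>x. x \<in> Q \<Longrightarrow> norm x \<le> B"
    using Q by (auto simp: bounded_pos)
  \<comment> \<open>The diameter of \<open>Q\<close> is at most \<open>2 * B\<close>, so prolonging by the ratio \<open>t\<close> moves at most \<open>e\<close> away from \<open>c\<close>.\<close>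
  define t where "t = e / (2 * B)"
  have t: "0 < t" using e B by (simp add: t_def)
  have "h q \<le> ((1 + t) * h c - m) / t" if q: "q \<in> Q" for q
  proof -
    define c' where "c' = (1 + t) *\<^sub>R c + (- t) *\<^sub>R q"
    have "c' \<in> affine hull Q"
      unfolding c'_def by (intro mem_affine) (auto simp: c q hull_inc)
    moreover have "c' \<in> cball c e"
    proof -
      have "norm (c - q) \<le> B + B"
        using norm_triangle_ineq4[of c q] B(2)[OF c] B(2)[OF q] by linarith
      then have "t * norm (c - q) \<le> t * (2 * B)"
        using t by (intro mult_left_mono) auto
      moreover have "c - c' = t *\<^sub>R (q - c)"
        by (simp add: c'_def algebra_simps)
      ultimately show ?thesis
        using B t e by (simp add: dist_norm t_def norm_minus_commute)
    qed
    ultimately have c': "c' \<in> Q" using e by blast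
    define u v where "u = 1 / (1 + t)" and "v = t / (1 + t)"
    have uv: "0 \<le> u" "0 \<le> v" "u + v = 1" "(1 + t) * u = 1" "(1 + t) * v = t"
      using t by (auto simp: u_def v_def field_simps)
    have "u *\<^sub>R c' + v *\<^sub>R q = (u * (1 + t)) *\<^sub>R c + (v - u * t) *\<^sub>R q"
      by (simp add: c'_def algebra_simps)
    also have "\<dots> = c"
      using t by (simp add: u_def v_def)
    finally have "u * h c' + v * h q \<le> h c"
      using h c' q uv by (metis concave_on_iff)
    then have "(1 + t) * (u * h c' + v * h q) \<le> (1 + t) * h c"
      using t by (intro mult_left_mono) auto
    moreover have "(1 + t) * (u * h c' + v * h q) = h c' + t * h q"
      using uv by (metis (no_types, lifting) distrib_left mult.assoc mult_1)
    ultimately show ?thesis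
      using m[OF c'] t by (simp add: field_simps)
  qed
  then show ?thesis by (rule that)
qed (use that in blast)

section \<open>The volume of the gap\<close>

lemma nn_integral_scaleR:
  fixes F :: "'a::euclidean_space \<Rightarrow> ennreal"
  assumes [measurable]: "F \<in> borel_measurable borel" and "0 < c"
  shows "(\<integral>\<^sup>+x. F x \<partial>lborel) = (\<integral>\<^sup>+x. ennreal (c ^ DIM('a)) * F (c *\<^sub>R x) \<partial>lborel)"
  using assms(2) by (subst lborel_affine[of c 0]) (auto simp: nn_integral_density nn_integral_distr)

lemma nn_integral_lborel_Pair:
  fixes F :: "'a::euclidean_space \<times> 'b::euclidean_space \<Rightarrow> ennreal"
  assumes [measurable]: "F \<in> borel_measurable borel"
  shows "(\<integral>\<^sup>+p. F p \<partial>lborel) = (\<integral>\<^sup>+x. \<integral>\<^sup>+y. F (x, y) \<partial>lborel \<partial>lborel)"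
    and "(\<integral>\<^sup>+p. F p \<partial>lborel) = (\<integral>\<^sup>+y. \<integral>\<^sup>+x. F (x, y) \<partial>lborel \<partial>lborel)"
proof -
  have F: "F \<in> borel_measurable (lborel \<Otimes>\<^sub>M lborel)"
    by (simp add: lborel_prod)
  show "(\<integral>\<^sup>+p. F p \<partial>lborel) = (\<integral>\<^sup>+x. \<integral>\<^sup>+y. F (x, y) \<partial>lborel \<partial>lborel)"
    using lborel.nn_integral_fst[OF F] by (simp add: lborel_prod)
  show "(\<integral>\<^sup>+p. F p \<partial>lborel) = (\<integral>\<^sup>+y. \<integral>\<^sup>+x. F (x, y) \<partial>lborel \<partial>lborel)"
    using lborel_pair.nn_integral_snd[OF F] by (simp add: lborel_prod)
qed

text \<open>
  The points with \<open>0 < z \<le> 1\<close> and \<open>x \<in> z Q\<close> that lie on or above the graph of \<open>g\<close> but strictly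
  below that of its perspective; \<open>x \<in> z Q\<close> is written \<open>x / z \<in> Q\<close>.
\<close>

definition perspective_gap :: "('a::real_vector \<Rightarrow> real) \<Rightarrow> 'a set \<Rightarrow> ('a \<times> real \<times> real) set" where
  "perspective_gap g Q =
     {(x, y, z). 0 < z \<and> z \<le> 1 \<and> x /\<^sub>R z \<in> Q \<and> g x \<le> y \<and> y < z * g (x /\<^sub>R z)}"

lemma borel_perspective_gap:
  fixes g :: "'a::euclidean_space \<Rightarrow> real"
  assumes [measurable]: "g \<in> borel_measurable borel" "Q \<in> sets borel"
  shows "perspective_gap g Q \<in> sets borel"
proof -
  have "perspective_gap g Q = {p \<in> space (borel \<Otimes>\<^sub>M borel \<Otimes>\<^sub>M borel).
      0 < snd (snd p) \<and> snd (snd p) \<le> 1 \<and> fst p /\<^sub>R snd (snd p) \<in> Q \<and>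
      g (fst p) \<le> fst (snd p) \<and> fst (snd p) < snd (snd p) * g (fst p /\<^sub>R snd (snd p))}"
    by (auto simp: perspective_gap_def space_pair_measure)
  also have "\<dots> \<in> sets (borel \<Otimes>\<^sub>M borel \<Otimes>\<^sub>M borel)"
    by measurable
  finally show ?thesis by (simp only: borel_prod)
qed

text \<open>
  No inequality between \<open>g\<close> and its perspective is assumed: where the integrand is negative, the
  fibre over \<open>(x, z)\<close> is empty and \<open>ennreal\<close> truncates the integrand to \<open>0\<close>.
\<close>

lemma emeasure_perspective_gap:
  fixes g :: "'a::euclidean_space \<Rightarrow> real"
  assumes g [measurable]: "g \<in> borel_measurable borel" and Q [measurable]: "Q \<in> sets borel"
  shows "emeasure lborel (perspective_gap g Q) =
    (\<integral>\<^sup>+z. \<integral>\<^sup>+x. ennreal (indicator ({0<..1} \<times> Q) (z, x) * (z ^ DIM('a) * (z * g x - g (z *\<^sub>R x))))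
       \<partial>lborel \<partial>lborel)"
proof -
  let ?D = "perspective_gap g Q"
  have D [measurable]: "?D \<in> sets borel" "?D \<in> sets (borel \<Otimes>\<^sub>M borel \<Otimes>\<^sub>M borel)"
    using borel_perspective_gap[OF g Q] by (simp_all only: borel_prod)
  let ?I = "\<lambda>x y z. indicator ?D (x, y, z) :: ennreal"
  let ?J = "\<lambda>z. indicator {0<..1} z :: real"
  have "emeasure lborel ?D = (\<integral>\<^sup>+p. indicator ?D p \<partial>lborel)"
    by simp
  also have "\<dots> = (\<integral>\<^sup>+p. \<integral>\<^sup>+x. indicator ?D (x, p) \<partial>lborel \<partial>lborel)"
    by (rule nn_integral_lborel_Pair) simp
  also have "\<dots> = (\<integral>\<^sup>+z. \<integral>\<^sup>+y. \<integral>\<^sup>+x. ?I x y z \<partial>lborel \<partial>lborel \<partial>lborel)"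
    by (rule nn_integral_lborel_Pair) (simp flip: borel_prod)
  also have "\<dots> = (\<integral>\<^sup>+z. \<integral>\<^sup>+x. \<integral>\<^sup>+y. ?I x y z \<partial>lborel \<partial>lborel \<partial>lborel)"
    by (intro nn_integral_cong lborel_pair.Fubini') simp
  also have "\<dots> = (\<integral>\<^sup>+z. \<integral>\<^sup>+x. ennreal (?J z * indicator Q (x /\<^sub>R z) * (z * g (x /\<^sub>R z) - g x)) \<partial>lborel \<partial>lborel)"
  proof (intro nn_integral_cong)
    fix z :: real and x :: 'a
    have "(\<integral>\<^sup>+y. ?I x y z \<partial>lborel) =
        (\<integral>\<^sup>+y. indicator (if z \<in> {0<..1} \<and> x /\<^sub>R z \<in> Q then {g x..<z * g (x /\<^sub>R z)} else {}) y \<partial>lborel)"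
      by (intro nn_integral_cong) (auto simp: perspective_gap_def indicator_def)
    also have "\<dots> = emeasure lborel (if z \<in> {0<..1} \<and> x /\<^sub>R z \<in> Q then {g x..<z * g (x /\<^sub>R z)} else {})"
      by (rule nn_integral_indicator) simp
    also have "\<dots> = ennreal (?J z * indicator Q (x /\<^sub>R z) * (z * g (x /\<^sub>R z) - g x))"
      by (cases "g x \<le> z * g (x /\<^sub>R z)") (auto simp: indicator_def ennreal_neg)
    finally show "(\<integral>\<^sup>+y. ?I x y z \<partial>lborel) = \<dots>" .
  qed
  also have "\<dots> = (\<integral>\<^sup>+z. \<integral>\<^sup>+x. ennreal (indicator ({0<..1} \<times> Q) (z, x) *
       (z ^ DIM('a) * (z * g x - g (z *\<^sub>R x)))) \<partial>lborel \<partial>lborel)"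
  proof (rule nn_integral_cong)
    fix z :: real
    show "(\<integral>\<^sup>+x. ennreal (?J z * indicator Q (x /\<^sub>R z) * (z * g (x /\<^sub>R z) - g x)) \<partial>lborel) =
      (\<integral>\<^sup>+x. ennreal (indicator ({0<..1} \<times> Q) (z, x) * (z ^ DIM('a) * (z * g x - g (z *\<^sub>R x)))) \<partial>lborel)"
    proof (cases "0 < z \<and> z \<le> 1")
      case True
      have "(\<integral>\<^sup>+x. ennreal (?J z * indicator Q (x /\<^sub>R z) * (z * g (x /\<^sub>R z) - g x)) \<partial>lborel) =
        (\<integral>\<^sup>+x. ennreal (z ^ DIM('a)) * ennreal (?J z * indicator Q ((z *\<^sub>R x) /\<^sub>R z) *
           (z * g ((z *\<^sub>R x) /\<^sub>R z) - g (z *\<^sub>R x))) \<partial>lborel)"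
        using True by (intro nn_integral_scaleR) auto
      also have "\<dots> = (\<integral>\<^sup>+x. ennreal (indicator ({0<..1} \<times> Q) (z, x) *
           (z ^ DIM('a) * (z * g x - g (z *\<^sub>R x)))) \<partial>lborel)"
        using True by (intro nn_integral_cong) (auto simp: indicator_def simp flip: ennreal_mult')
      finally show ?thesis .
    qed (auto simp: indicator_def)
  qed
  finally show ?thesis .
qed

lemma measure_perspective_gap:
  fixes g :: "'a::euclidean_space \<Rightarrow> real"
  assumes g [measurable]: "g \<in> borel_measurable borel" and Q: "compact Q"
    and B: "\<And>x. \<bar>g x\<bar> \<le> B"
    and le: "\<And>z x. 0 < z \<Longrightarrow> z \<le> 1 \<Longrightarrow> x \<in> Q \<Longrightarrow> g (z *\<^sub>R x) \<le> z * g x"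
  shows "measure lborel (perspective_gap g Q) =
    1 / (real DIM('a) + 2) * (LINT x:Q|lborel. g x)
      - (LINT z:{0..1}|lborel. z ^ DIM('a) * (LINT x:Q|lborel. g (z *\<^sub>R x)))"
proof -
  have [measurable]: "Q \<in> sets borel"
    using Q by (simp add: borel_compact)
  let ?n = "DIM('a)"
  let ?C = "{0..1::real} \<times> Q"
  define h1 h2 :: "real \<times> 'a \<Rightarrow> real"
    where "h1 p = indicator ?C p *\<^sub>R (fst p ^ (?n + 1) * g (snd p))"
      and "h2 p = indicator ?C p *\<^sub>R (fst p ^ ?n * g (fst p *\<^sub>R snd p))" for p
  have C: "?C \<in> sets lborel" "emeasure lborel ?C < \<infinity>"
    using emeasure_bounded_finite[of ?C] borel_compact[of ?C]
    by (simp_all add: Q bounded_Times compact_imp_bounded compact_Times)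
  have bound: "\<bar>z ^ k * r\<bar> \<le> B" if "0 \<le> z" "z \<le> 1" "\<bar>r\<bar> \<le> B" for z r :: real and k
  proof -
    have "\<bar>z ^ k\<bar> * \<bar>r\<bar> \<le> 1 * B"
      using that by (intro mult_mono) (auto simp: power_le_one)
    then show ?thesis by (simp add: abs_mult)
  qed
  have h1: "integrable lborel h1"
    unfolding h1_def
    by (rule integrableI_bounded_set_indicator[OF C(1) _ C(2), of _ B])
       (auto intro!: bound B AE_I2 simp del: power_Suc simp flip: borel_prod)
  have h2: "integrable lborel h2"
    unfolding h2_def
    by (rule integrableI_bounded_set_indicator[OF C(1) _ C(2), of _ B])
       (auto intro!: bound B AE_I2 simp flip: borel_prod)
  \<comment> \<open>At \<open>z = 0\<close> the left side vanishes because \<open>z ^ DIM('a)\<close> does, so that \<open>{0..1}\<close> may replace \<open>{0<..1}\<close>.\<close>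
  have h: "h1 p - h2 p =
      indicator ({0<..1} \<times> Q) p * (fst p ^ ?n * (fst p * g (snd p) - g (fst p *\<^sub>R snd p)))" for p
    by (cases p) (auto simp: h1_def h2_def indicator_def zero_power algebra_simps)
  have nonneg: "0 \<le> h1 p - h2 p" for p
    unfolding h by (cases p) (auto simp: indicator_def intro!: mult_nonneg_nonneg le)
  have "emeasure lborel (perspective_gap g Q) = (\<integral>\<^sup>+z. \<integral>\<^sup>+x. ennreal (h1 (z, x) - h2 (z, x)) \<partial>lborel \<partial>lborel)"
    unfolding h by (subst emeasure_perspective_gap) auto
  also have "\<dots> = (\<integral>\<^sup>+p. ennreal (h1 p - h2 p) \<partial>lborel)"
    using h1 h2 by (subst nn_integral_lborel_Pair(1)) auto
  also have "\<dots> = ennreal (LINT p|lborel. h1 p - h2 p)"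
    using h1 h2 nonneg by (intro nn_integral_eq_integral) auto
  finally have "measure lborel (perspective_gap g Q) = (LINT p|lborel. h1 p - h2 p)"
    using nonneg by (simp add: measure_def integral_nonneg_AE)
  also have "\<dots> = (LINT p|lborel. h1 p) - (LINT p|lborel. h2 p)"
    using h1 h2 by (rule Bochner_Integration.integral_diff)
  also have "(LINT p|lborel. h1 p) = (LINT z|lborel. LINT x|lborel. h1 (z, x))"
    using lborel_pair.integral_fst'[of h1] h1 by (simp add: lborel_prod)
  also have "\<dots> = (LINT z|lborel. (z ^ (?n + 1) * indicator {0..1} z) * (LINT x:Q|lborel. g x))"
    unfolding set_lebesgue_integral_def h1_def
    by (intro Bochner_Integration.integral_cong)
       (auto simp: indicator_times mult_ac simp flip: Bochner_Integration.integral_mult_right_zero)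
  also have "\<dots> = 1 / (real ?n + 2) * (LINT x:Q|lborel. g x)"
    using integral_power[of 0 1 "?n + 1"] by (simp add: add_ac del: power_Suc)
  also have "(LINT p|lborel. h2 p) = (LINT z|lborel. LINT x|lborel. h2 (z, x))"
    using lborel_pair.integral_fst'[of h2] h2 by (simp add: lborel_prod)
  also have "\<dots> = (LINT z:{0..1}|lborel. z ^ ?n * (LINT x:Q|lborel. g (z *\<^sub>R x)))"
    unfolding set_lebesgue_integral_def h2_def
    by (intro Bochner_Integration.integral_cong)
       (auto simp: indicator_times mult_ac simp flip: Bochner_Integration.integral_mult_right_zero)
  finally show ?thesis .
qed

section \<open>Reduction to the gap\<close>

lemma scaleR_mem_convex_hull_insert_0:
  assumes "x \<in> Q" "0 \<le> z" "z \<le> 1"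
  shows "z *\<^sub>R x \<in> convex hull (Q \<union> {0})"
proof -
  have "z *\<^sub>R x + (1 - z) *\<^sub>R 0 \<in> convex hull (Q \<union> {0})"
    using assms by (intro convexD[OF convex_convex_hull]) (auto intro: hull_inc)
  then show ?thesis by simp
qed

lemma convex_on_scaleR_le:
  assumes "convex_on (convex hull (Q \<union> {0})) f" "f 0 = 0" "x \<in> Q" "0 \<le> z" "z \<le> 1"
  shows "f (z *\<^sub>R x) \<le> z * f x"
  using convex_onD[OF assms(1), of z 0 x] assms by (auto simp: hull_inc)

lemma volume_gap_eq_measure_perspective_gap:
  fixes f \<mu> :: "'a::euclidean_space \<Rightarrow> real"
  assumes Q: "compact Q" "convex Q"
    and f: "continuous_on (convex hull (Q \<union> {0})) f" "convex_on (convex hull (Q \<union> {0})) f" "f 0 = 0"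
    and \<mu>: "concave_upper_bound_on Q f \<mu>"
  shows "volume_gap (naive_relaxation f \<mu> Q) (perspective_relaxation f \<mu> Q) =
    measure lebesgue (perspective_gap f Q)"
proof -
  let ?K = "convex hull (Q \<union> {0})"
  have K: "compact ?K" "convex ?K" and QK: "Q \<subseteq> ?K"
    using Q(1) by (auto intro: compact_convex_hull compact_Un hull_inc)
  \<comment> \<open>\<open>S\<close> is the perspective relaxation before convexification and closure, \<open>A\<close> the part of the
    naive relaxation with \<open>z > 0\<close>.\<close>
  define S where "S = {(x, y, z). 0 < z \<and> z \<le> 1 \<and> x /\<^sub>R z \<in> Q \<and>
    z * f (x /\<^sub>R z) \<le> y \<and> y \<le> z * \<mu> (x /\<^sub>R z)}"
  define A where "A = {(x, y, z). 0 < z \<and> z \<le> 1 \<and> x /\<^sub>R z \<in> Q \<and>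
    f x \<le> y \<and> y \<le> z * \<mu> (x /\<^sub>R z)}"
  have scale: "x \<in> (\<lambda>q. z *\<^sub>R q) ` Q \<longleftrightarrow> x /\<^sub>R z \<in> Q" if "0 < z" for x :: 'a and z :: real
    using that by (auto simp: image_iff intro!: bexI[of _ "x /\<^sub>R z"])
  have f\<mu>: "f q \<le> \<mu> q" if "q \<in> Q" for q
    using \<mu> that by (auto simp: concave_upper_bound_on_def)
  have conc: "concave_on Q \<mu>"
    using \<mu> by (simp add: concave_upper_bound_on_def)
  have inK: "x \<in> ?K" if "x /\<^sub>R z \<in> Q" "0 < z" "z \<le> 1" for x z
    using scaleR_mem_convex_hull_insert_0[OF that(1), of z] that by simp
  have le: "f x \<le> z * f (x /\<^sub>R z)" if "x /\<^sub>R z \<in> Q" "0 < z" "z \<le> 1" for x z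
    using convex_on_scaleR_le[OF f(2,3) that(1), of z] that by simp

  have strip: "convex {(x :: 'a, y :: real, z). z \<le> (1::real)}"
    by (auto simp: convex_def intro: convex_bound_le)
  have hypo: "convex {(q, t). q \<in> Q \<and> t \<le> \<mu> q}"
  proof -
    have "{(q, t). q \<in> Q \<and> t \<le> \<mu> q} = (\<lambda>(q, t). (q, - t)) -` epigraph Q (\<lambda>q. - \<mu> q)"
      by (auto simp: mem_epigraph)
    moreover have "linear (\<lambda>(q :: 'a, t :: real). (q, - t))"
      by (auto simp: linear_iff)
    ultimately show ?thesis
      using conc by (simp add: convex_linear_vimage convex_epigraph concave_on_def)
  qed
  have epi: "convex {(q, t). q \<in> Q \<and> f q \<le> t}"
  proof -
    have "convex_on Q f" using f(2) QK Q(2) by (rule convex_on_subset)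
    then show ?thesis by (simp add: epigraph_def case_prod_unfold flip: convex_epigraph)
  qed
  have epiK: "convex {(x, y, z :: real). x \<in> ?K \<and> f x \<le> y}"
  proof -
    have "{(x, y, z :: real). x \<in> ?K \<and> f x \<le> y} = (\<lambda>(x, y, z). (x, y)) -` epigraph ?K f"
      by (auto simp: mem_epigraph)
    moreover have "linear (\<lambda>(x :: 'a, y :: real, z :: real). (x, y))"
      by (auto simp: linear_iff)
    ultimately show ?thesis
      using f(2) by (simp add: convex_linear_vimage convex_epigraph del: insert_is_Un)
  qed
  have "S = {(x, y, z). 0 < z \<and> (x /\<^sub>R z, y / z) \<in> {(q, t). q \<in> Q \<and> t \<le> \<mu> q}} \<inter>
      {(x, y, z). 0 < z \<and> (x /\<^sub>R z, y / z) \<in> {(q, t). q \<in> Q \<and> f q \<le> t}} \<inter> {(x, y, z). z \<le> 1}"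
    by (auto simp: S_def field_simps)
  then have S_convex: "convex S"
    using convex_perspective_cone[OF hypo] convex_perspective_cone[OF epi] strip
    by (simp only: convex_Int)
  have "A = {(x, y, z). 0 < z \<and> (x /\<^sub>R z, y / z) \<in> {(q, t). q \<in> Q \<and> t \<le> \<mu> q}} \<inter>
      {(x, y, z). x \<in> ?K \<and> f x \<le> y} \<inter> {(x, y, z). z \<le> 1}"
    using inK by (auto simp: A_def pos_divide_le_eq mult.commute)
  then have A_convex: "convex A"
    using convex_perspective_cone[OF hypo] epiK strip by (simp only: convex_Int)

  have "bounded (f ` ?K)"
    using f(1) K(1) by (intro compact_imp_bounded compact_continuous_image)
  then obtain m where m: "\<And>x. x \<in> ?K \<Longrightarrow> \<bar>f x\<bar> \<le> m"
    unfolding bounded_real by blast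
  have "- m \<le> \<mu> q" if "q \<in> Q" for q
    using m[of q] f\<mu>[OF that] that QK by (auto simp: abs_le_iff)
  then obtain M where M: "\<And>q. q \<in> Q \<Longrightarrow> \<mu> q \<le> M"
    using concave_on_bounded_above[OF conc compact_imp_bounded[OF Q(1)]] by blast
  have "A \<subseteq> ?K \<times> {- m..\<bar>M\<bar>} \<times> {0..1}"
  proof -
    have "x \<in> ?K \<and> - m \<le> y \<and> y \<le> \<bar>M\<bar>"
      if *: "0 < z" "z \<le> 1" "x /\<^sub>R z \<in> Q" "f x \<le> y" "y \<le> z * \<mu> (x /\<^sub>R z)" for x y and z :: real
    proof (intro conjI)
      show "x \<in> ?K" using * by (intro inK)
      then show "- m \<le> y" using m[of x] *(4) by linarith
      have "z * \<mu> (x /\<^sub>R z) \<le> z * \<bar>M\<bar>"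
        using *(1) M[OF *(3)] by (intro mult_left_mono) auto
      also have "\<dots> \<le> 1 * \<bar>M\<bar>" using * by (intro mult_right_mono) auto
      finally show "y \<le> \<bar>M\<bar>" using *(5) by linarith
    qed
    then show ?thesis by (auto simp: A_def)
  qed
  then have A_bounded: "bounded A"
    by (rule bounded_subset[rotated]) (intro bounded_Times compact_imp_bounded[OF K(1)] bounded_closed_interval)
  have SA: "S \<subseteq> A"
    using le by (fastforce simp: S_def A_def)
  then have S_bounded: "bounded S" using A_bounded bounded_subset by blast

  have "perspective_relaxation f \<mu> Q = closure (convex hull S)"
    unfolding perspective_relaxation_def S_def
    by (intro arg_cong[where f = "\<lambda>X. closure (convex hull X)"])
       (auto simp: perspective_fun_def scale)
  then have P: "measure lebesgue (perspective_relaxation f \<mu> Q) = measure lebesgue S"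
    by (simp only: hull_same[of convex S, OF S_convex]
        measure_closure[OF S_bounded negligible_convex_frontier[OF S_convex]])

  have nA: "A \<subseteq> naive_relaxation f \<mu> Q" "naive_relaxation f \<mu> Q - A \<subseteq> {(0, 0, 0)}"
  proof -
    have "(x, y, z) \<in> naive_relaxation f \<mu> Q \<longleftrightarrow>
        (x, y, z) \<in> A \<or> z = 0 \<and> x = 0 \<and> y = 0 \<and> Q \<noteq> {}" for x y z
    proof (cases "0 < z")
      case True
      then show ?thesis
        unfolding naive_relaxation_def A_def by (simp add: perspective_fun_def scale) blast
    next
      case False
      then show ?thesis
        using f(3) by (auto simp: naive_relaxation_def A_def perspective_fun_def image_constant_conv)
    qed
    then show "A \<subseteq> naive_relaxation f \<mu> Q" "naive_relaxation f \<mu> Q - A \<subseteq> {(0, 0, 0)}"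
      by auto
  qed
  have "measure lebesgue (naive_relaxation f \<mu> Q) = measure lebesgue A"
  proof (rule measure_negligible_symdiff)
    show "A \<in> lmeasurable" using A_convex A_bounded measurable_convex by blast
    show "negligible (A - naive_relaxation f \<mu> Q \<union> (naive_relaxation f \<mu> Q - A))"
      using nA by (intro negligible_subset[OF negligible_sing[of "(0, 0, 0)"]]) blast
  qed
  then have "volume_gap (naive_relaxation f \<mu> Q) (perspective_relaxation f \<mu> Q) = measure lebesgue (A - S)"
    unfolding volume_gap_def P
    using measurable_measure_Diff[OF measurable_convex[OF A_convex A_bounded]
        fmeasurableD[OF measurable_convex[OF S_convex S_bounded]] SA]
    by linarith
  also have "A - S = perspective_gap f Q"
  proof -
    have "y \<le> z * \<mu> (x /\<^sub>R z)" if "0 < z" "x /\<^sub>R z \<in> Q" "y < z * f (x /\<^sub>R z)" for x y z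
      using that mult_left_mono[OF f\<mu>[OF that(2)], of z] by linarith
    then show ?thesis by (auto simp: A_def S_def perspective_gap_def)
  qed
  finally show ?thesis .
qed

lemma volume_gap_eq:
  fixes f \<mu> :: "'a::euclidean_space \<Rightarrow> real"
  assumes Q: "compact Q" "convex Q"
    and f: "continuous_on (convex hull (Q \<union> {0})) f" "convex_on (convex hull (Q \<union> {0})) f" "f 0 = 0"
    and \<mu>: "concave_upper_bound_on Q f \<mu>"
  shows "volume_gap (naive_relaxation f \<mu> Q) (perspective_relaxation f \<mu> Q) =
    1 / (real DIM('a) + 2) * (LINT x:Q|lebesgue. f x)
      - (LINT z:{0..1}|lebesgue. z ^ DIM('a) * (LINT x:Q|lebesgue. f (z *\<^sub>R x)))"
proof -
  let ?K = "convex hull (Q \<union> {0})"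
  have K: "compact ?K" and QK: "Q \<subseteq> ?K"
    using Q(1) by (auto intro: compact_convex_hull compact_Un hull_inc)
  have [measurable]: "Q \<in> sets borel" "?K \<in> sets borel"
    using Q K by (simp_all add: borel_compact)
  \<comment> \<open>Nothing is known about \<open>f\<close> outside \<open>?K\<close>; its extension by zero is bounded and Borel measurable,
    and agrees with \<open>f\<close> at every point \<open>z *\<^sub>R x\<close> that matters.\<close>
  define g where "g x = indicator ?K x *\<^sub>R f x" for x
  have g [measurable]: "g \<in> borel_measurable borel"
    unfolding g_def using f(1) by (intro borel_measurable_continuous_on_indicator \<open>?K \<in> sets borel\<close>)
  have gf: "g (z *\<^sub>R x) = f (z *\<^sub>R x)" if "x \<in> Q" "0 \<le> z" "z \<le> 1" for x z
    using scaleR_mem_convex_hull_insert_0[OF that] by (simp add: g_def)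
  have gf1: "g x = f x" if "x \<in> Q" for x
    using gf[OF that, of 1] by simp
  have "bounded (f ` ?K)"
    using f(1) K(1) by (intro compact_imp_bounded compact_continuous_image)
  then obtain B where "\<And>x. x \<in> ?K \<Longrightarrow> \<bar>f x\<bar> \<le> B"
    unfolding bounded_real by blast
  then have B: "\<bar>g x\<bar> \<le> \<bar>B\<bar>" for x
    by (fastforce simp: g_def indicator_def)
  have gap: "perspective_gap f Q = perspective_gap g Q"
  proof -
    have "g x = f x" if "0 < z" "z \<le> 1" "x /\<^sub>R z \<in> Q" for x z
      using gf[OF that(3), of z] that by simp
    then show ?thesis by (auto simp: perspective_gap_def gf1)
  qed
  have leb: "(LINT x:X|lebesgue. F x) = (LINT x:X|lborel. F x)"
    if "F \<in> borel_measurable borel" "X \<in> sets borel" for F :: "'b::euclidean_space \<Rightarrow> real" and X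
    unfolding set_lebesgue_integral_def using that by (intro integral_completion) auto
  have "measure lebesgue (perspective_gap f Q) = measure lborel (perspective_gap g Q)"
    using borel_perspective_gap[OF g] by (simp add: gap measure_completion)
  also have "\<dots> = 1 / (real DIM('a) + 2) * (LINT x:Q|lborel. g x)
      - (LINT z:{0..1}|lborel. z ^ DIM('a) * (LINT x:Q|lborel. g (z *\<^sub>R x)))"
    by (rule measure_perspective_gap[OF g Q(1) B])
       (use gf gf1 convex_on_scaleR_le[OF f(2,3)] in auto)
  also have "(LINT x:Q|lborel. g x) = (LINT x:Q|lebesgue. f x)"
    by (subst leb[symmetric]) (auto intro!: set_lebesgue_integral_cong simp: gf1)
  also have "(LINT z:{0..1}|lborel. z ^ DIM('a) * (LINT x:Q|lborel. g (z *\<^sub>R x))) =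
     (LINT z:{0..1}|lebesgue. z ^ DIM('a) * (LINT x:Q|lborel. g (z *\<^sub>R x)))"
    unfolding set_lebesgue_integral_def
    by (subst leb[unfolded set_lebesgue_integral_def]) auto
  also have "\<dots> = (LINT z:{0..1}|lebesgue. z ^ DIM('a) * (LINT x:Q|lebesgue. f (z *\<^sub>R x)))"
  proof (intro set_lebesgue_integral_cong allI impI)
    fix z :: real assume z: "z \<in> {0..1}"
    have "(LINT x:Q|lborel. g (z *\<^sub>R x)) = (LINT x:Q|lebesgue. f (z *\<^sub>R x))"
      using z by (subst leb[symmetric]) (auto intro!: set_lebesgue_integral_cong simp: gf)
    then show "z ^ DIM('a) * (LINT x:Q|lborel. g (z *\<^sub>R x)) = z ^ DIM('a) * (LINT x:Q|lebesgue. f (z *\<^sub>R x))"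
      by simp
  qed auto
  finally show ?thesis
    by (simp only: volume_gap_eq_measure_perspective_gap[OF assms])
qed

theorem corollary2p3:
  fixes Q :: "(real ^ 'n) set"
    and f \<mu> :: "real ^ 'n \<Rightarrow> real"
  assumes "polytope Q"
    and "Q \<subseteq> {x. \<forall>i. 0 \<le> x $ i} - {0}"
    and "continuous_on (convex hull (Q \<union> {0})) f"
    and "convex_on (convex hull (Q \<union> {0})) f"
    and "f 0 = 0"
    and "concave_upper_bound_on Q f \<mu>"
  shows "volume_gap (naive_relaxation f \<mu> Q) (perspective_relaxation f \<mu> Q) =
    1 / (real CARD('n) + 2) * (LINT x:Q|lebesgue. f x)
      - (LINT z:{0..1}|lebesgue. z ^ CARD('n) * (LINT x:Q|lebesgue. f (z *\<^sub>R x)))"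
  using volume_gap_eq[OF polytope_imp_compact[OF assms(1)] polytope_imp_convex[OF assms(1)] assms(3-6)]
  by simp

end
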